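(* Let $n,k,m$ be positive integers with $n=mk$, let $D\in\mathcal S^n$ be an entrywise nonnegative (weight) matrix, and let $L:=\operatorname{Diag}(D\mathbf 1_n)-D$ be the corresponding weighted Laplacian matrix. Then the binary semidefinite program $$\min\;\tfrac12\langle L,X\rangle\quad\text{s.t.}\quad \operatorname{diag}(X)=\mathbf 1_n,\quad X\mathbf 1_n=\tfrac nk\mathbf 1_n,\quad kX-\mathbf J_n\succeq\mathbf 0,\quad X\in\mathcal S^n,\quad X\in\{0,1\}^{n\times n}$$ is equivalent to the mixed-integer semidefinite program $$\min\;\tfrac12\langle D,X_1\rangle\quad\text{s.t.}\quad (m-1)\mathbf I_n-X_2\succeq\mathbf 0,\quad (k-1)\mathbf I_n-X_1+(k-1)X_2\succeq\mathbf 0,$$ $$\mathbf I_n+X_1+X_2=\mathbf J_n,\quad X_1,X_2\in\mathcal S^n,\quad X_1\ge\mathbf 0,\quad X_2\in\{0,1\}^{n\times n}.$$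
   Context: Both programs model the $k$-equipartition problem: partition $n=mk$ vertices, with pairwise weights given by the matrix $D$, into $k$ sets of size $m$ so that the total weight of edges joining different sets is minimized. $\mathcal S^n$ is the set of real symmetric $n\times n$ matrices; $\mathbf 1_n$ is the all-ones vector; $\mathbf I_n$ and $\mathbf J_n$ are the identity and the all-ones matrix of order $n$; $\operatorname{Diag}(v)$ is the diagonal matrix with diagonal $v$ and $\operatorname{diag}(X)$ is the vector of diagonal entries of $X$; $\langle X,Y\rangle=\operatorname{tr}(X^\top Y)$; $\succeq\mathbf 0$ means positive semidefinite; $X\ge\mathbf 0$ is entrywise. Two optimization problems are called equivalent if every feasible solution of either one yields a feasible solution of the other with the same objective value. *)

theory Defs
  imports "HOL-Analysis.Analysis"
begin

definition sym_mat :: "real^'n^'n \<Rightarrow> bool" where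
  "sym_mat A \<longleftrightarrow> transpose A = A"

definition psd :: "real^'n^'n \<Rightarrow> bool" where
  "psd A \<longleftrightarrow> sym_mat A \<and> (\<forall>v. 0 \<le> v \<bullet> (A *v v))"

definition ones_vec :: "real^'n" where
  "ones_vec = (\<chi> i. 1)"

definition ones_mat :: "real^'n^'n" where
  "ones_mat = (\<chi> i j. 1)"

definition Diag :: "real^'n \<Rightarrow> real^'n^'n" where
  "Diag v = (\<chi> i j. if i = j then v $ i else 0)"

definition diag_vec :: "real^'n^'n \<Rightarrow> real^'n" where
  "diag_vec X = (\<chi> i. X $ i $ i)"

definition mat_inner :: "real^'n^'n \<Rightarrow> real^'n^'n \<Rightarrow> real" where
  "mat_inner X Y = trace (transpose X ** Y)"

definition nonneg_mat :: "real^'n^'n \<Rightarrow> bool" where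
  "nonneg_mat X \<longleftrightarrow> (\<forall>i j. 0 \<le> X $ i $ j)"

definition binary_mat :: "real^'n^'n \<Rightarrow> bool" where
  "binary_mat X \<longleftrightarrow> (\<forall>i j. X $ i $ j \<in> {0, 1})"

definition laplacian :: "real^'n^'n \<Rightarrow> real^'n^'n" where
  "laplacian D = Diag (D *v ones_vec) - D"

record 'x min_problem =
  feasible :: "'x set"
  objective :: "'x \<Rightarrow> real"

definition equivalent_problems :: "'x min_problem \<Rightarrow> 'y min_problem \<Rightarrow> bool" where
  "equivalent_problems P Q \<longleftrightarrow>
     (\<forall>x \<in> feasible P. \<exists>y \<in> feasible Q. objective Q y = objective P x) \<and>
     (\<forall>y \<in> feasible Q. \<exists>x \<in> feasible P. objective P x = objective Q y)"

text \<open>The order \<open>n\<close> of the matrices is \<open>CARD('n)\<close>.\<close>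

definition binary_sdp :: "nat \<Rightarrow> real^'n^'n \<Rightarrow> (real^'n^'n) min_problem" where
  "binary_sdp k L =
     \<lparr>feasible = {X. diag_vec X = ones_vec \<and>
                    X *v ones_vec = (real CARD('n) / real k) *\<^sub>R ones_vec \<and>
                    psd (real k *\<^sub>R X - ones_mat) \<and>
                    sym_mat X \<and> binary_mat X},
      objective = (\<lambda>X. 1/2 * mat_inner L X)\<rparr>"

definition mixed_integer_sdp ::
    "nat \<Rightarrow> nat \<Rightarrow> real^'n^'n \<Rightarrow> ((real^'n^'n) \<times> (real^'n^'n)) min_problem" where
  "mixed_integer_sdp k m D =
     \<lparr>feasible = {(X1, X2). psd ((real m - 1) *\<^sub>R mat 1 - X2) \<and>
                    psd ((real k - 1) *\<^sub>R mat 1 - X1 + (real k - 1) *\<^sub>R X2) \<and>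
                    mat 1 + X1 + X2 = ones_mat \<and>
                    sym_mat X1 \<and> sym_mat X2 \<and>
                    nonneg_mat X1 \<and> binary_mat X2},
      objective = (\<lambda>(X1, X2). 1/2 * mat_inner D X1)\<rparr>"

end

theory Submission
  imports Defs
begin

text \<open>
  The correspondence is \<open>X = I + X\<^sub>2 = J - X\<^sub>1\<close>; it turns the two semidefinite constraints of the
  mixed-integer program into \<open>m I - X \<succeq> 0\<close> and \<open>k X - J \<succeq> 0\<close>. If all row sums of the symmetric
  nonnegative matrix \<open>X\<close> are \<open>m\<close>, then \<open>m I - X\<close> is a weighted Laplacian, hence positive
  semidefinite. Conversely, evaluating both constraints at the all-ones vector \<open>1\<close> gives
  \<open>m n \<le> 1\<^sup>T X 1 \<le> m n\<close>, so \<open>1\<close> is isotropic for the positive semidefinite matrix \<open>m I - X\<close> and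
  thus lies in its kernel.
\<close>

lemma sym_mat_nth: "sym_mat A \<Longrightarrow> A $ i $ j = A $ j $ i"
  by (simp add: sym_mat_def transpose_def vec_eq_iff)

lemma sym_matI: "(\<And>i j. A $ i $ j = A $ j $ i) \<Longrightarrow> sym_mat A"
  by (simp add: sym_mat_def transpose_def vec_eq_iff)

lemma sym_mat_inner:
  assumes "sym_mat A"
  shows "v \<bullet> (A *v w) = w \<bullet> (A *v v)"
  using assms by (metis dot_lmul_matrix inner_commute sym_mat_def transpose_matrix_vector)

lemma quadratic_form_sum:
  fixes A :: "real^'n^'n"
  shows "v \<bullet> (A *v v) = (\<Sum>i\<in>UNIV. \<Sum>j\<in>UNIV. A $ i $ j * v $ i * v $ j)"
  by (simp add: inner_vec_def matrix_vector_mult_def sum_distrib_left mult_ac)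

lemma mult_ones_vec_nth: "(A *v ones_vec) $ i = (\<Sum>j\<in>UNIV. A $ i $ j)"
  by (simp add: matrix_vector_mult_def ones_vec_def)

lemma inner_ones_vec: "ones_vec \<bullet> (ones_vec :: real^'n) = real CARD('n)"
  by (simp add: inner_vec_def ones_vec_def)

lemma ones_mat_mult_ones_vec: "ones_mat *v (ones_vec :: real^'n) = real CARD('n) *\<^sub>R ones_vec"
  by (simp add: vec_eq_iff mult_ones_vec_nth ones_mat_def) (simp add: ones_vec_def)

text \<open>If \<open>w = A *v v\<close> were nonzero, the derivative of the quadratic form at
  \<open>v\<close> in direction \<open>w\<close> would be positive, so a step from \<open>v\<close>
  along \<open>-w\<close> would take the form below its value 0.\<close>

lemma psd_isotropic_imp_kernel:
  assumes "psd A" and "v \<bullet> (A *v v) = 0"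
  shows "A *v v = 0"
proof (rule ccontr)
  assume nz: "A *v v \<noteq> 0"
  define w where "w = A *v v"
  define a where "a = w \<bullet> w"
  define c where "c = w \<bullet> (A *v w)"
  \<comment> \<open>The form at \<open>v + t w\<close> equals \<open>2 t a + t^2 c\<close>. This
    step length, with \<open>+ 1\<close> guarding against \<open>c = 0\<close>, turns it into
    \<open>t (a - t)\<close>, a product of a negative and a positive number.\<close>
  define t where "t = - a / (c + 1)"
  have a: "a > 0" using nz by (simp add: a_def w_def)
  have c: "c \<ge> 0" using assms(1) by (simp add: c_def psd_def)
  have t: "t * (c + 1) = - a" and "t < 0"
    using a c by (simp_all add: t_def divide_neg_pos)
  have "A *v (v + t *\<^sub>R w) = w + t *\<^sub>R (A *v w)"
    by (simp add: matrix_vector_right_distrib matrix_vector_mult_scaleR w_def)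
  moreover have "v \<bullet> (A *v w) = a"
    unfolding a_def using assms(1) sym_mat_inner[of A v w] by (simp add: psd_def w_def)
  moreover have "v \<bullet> w = 0"
    using assms(2) by (simp add: w_def)
  ultimately have "(v + t *\<^sub>R w) \<bullet> (A *v (v + t *\<^sub>R w)) = t * a + (t * a + t * (t * c))"
    by (simp add: inner_add_left inner_add_right a_def c_def distrib_left)
  also have "\<dots> = t * (2 * a + t * (c + 1) - t)"
    by (simp add: algebra_simps)
  also have "\<dots> = t * (a - t)"
    by (simp add: t)
  also have "\<dots> < 0"
    using a \<open>t < 0\<close> by (simp add: mult_neg_pos)
  finally show False
    using assms(1) by (simp add: psd_def not_le[symmetric])
qed

text \<open>The quadratic form of this weighted Laplacian is half the sum of
  \<open>X $ i $ j * (v $ i - v $ j)\<^sup>2\<close>; the two square terms are the row and column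
  sums, which agree by symmetry.\<close>

lemma psd_row_sum_minus:
  fixes X :: "real^'n^'n"
  assumes sym: "sym_mat X" and nonneg: "nonneg_mat X" and row: "X *v ones_vec = r *\<^sub>R ones_vec"
  shows "psd (r *\<^sub>R mat 1 - X)"
  unfolding psd_def
proof (intro conjI allI)
  show "sym_mat (r *\<^sub>R mat 1 - X)"
    using sym_mat_nth[OF sym] by (intro sym_matI) (auto simp: mat_def)
  fix v :: "real^'n"
  have rs: "(\<Sum>j\<in>UNIV. X $ i $ j) = r" for i
    using row by (simp add: vec_eq_iff mult_ones_vec_nth) (simp add: ones_vec_def)
  have sq: "(\<Sum>i\<in>UNIV. \<Sum>j\<in>UNIV. X $ i $ j * (v $ i)\<^sup>2) = r * (v \<bullet> v)"
    by (simp add: sum_distrib_right[symmetric] rs inner_vec_def sum_distrib_left power2_eq_square)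
  have sq': "(\<Sum>i\<in>UNIV. \<Sum>j\<in>UNIV. X $ i $ j * (v $ j)\<^sup>2) = r * (v \<bullet> v)"
    by (subst sum.swap, subst sq[symmetric]) (intro sum.cong refl, simp add: sym_mat_nth[OF sym])
  have "0 \<le> (\<Sum>i\<in>UNIV. \<Sum>j\<in>UNIV. X $ i $ j * (v $ i - v $ j)\<^sup>2)"
    using nonneg by (intro sum_nonneg) (simp add: nonneg_mat_def)
  also have "\<dots> = (\<Sum>i\<in>UNIV. \<Sum>j\<in>UNIV. X $ i $ j * (v $ i)\<^sup>2 + X $ i $ j * (v $ j)\<^sup>2
      - 2 * (X $ i $ j * v $ i * v $ j))"
    by (intro sum.cong refl) (simp add: power2_eq_square algebra_simps)
  also have "\<dots> = 2 * (r * (v \<bullet> v) - v \<bullet> (X *v v))"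
    by (simp add: sum.distrib sum_subtractf sq sq' quadratic_form_sum sum_distrib_left[symmetric])
  finally show "0 \<le> v \<bullet> ((r *\<^sub>R mat 1 - X) *v v)"
    by (simp add: matrix_vector_mult_diff_rdistrib scaleR_matrix_vector_assoc[symmetric]
        inner_diff_right)
qed

lemma row_sums_of_psd_bounds:
  fixes X :: "real^'n^'n"
  assumes upper: "psd (r *\<^sub>R mat 1 - X)" and lower: "psd (s *\<^sub>R X - ones_mat)"
    and "0 < s" and card: "real CARD('n) = r * s"
  shows "X *v ones_vec = r *\<^sub>R ones_vec"
proof -
  let ?e = "ones_vec :: real^'n"
  have u: "(r *\<^sub>R mat 1 - X) *v ?e = r *\<^sub>R ?e - X *v ?e"
    by (simp add: matrix_vector_mult_diff_rdistrib scaleR_matrix_vector_assoc[symmetric])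
  have "0 \<le> ?e \<bullet> ((s *\<^sub>R X - ones_mat) *v ?e)"
    using lower by (simp add: psd_def)
  \<comment> \<open>The all-ones matrix contributes the squared order, and \<open>card\<close>
    rewrites one factor as \<open>r * s\<close>, so that \<open>s\<close> can be divided
    out.\<close>
  also have "\<dots> = s * (?e \<bullet> (X *v ?e) - r * (?e \<bullet> ?e))"
    by (simp add: matrix_vector_mult_diff_rdistrib scaleR_matrix_vector_assoc[symmetric]
        inner_diff_right ones_mat_mult_ones_vec inner_ones_vec card algebra_simps)
  finally have "r * (?e \<bullet> ?e) \<le> ?e \<bullet> (X *v ?e)"
    using \<open>0 < s\<close> by (simp add: zero_le_mult_iff)
  moreover have "0 \<le> ?e \<bullet> (r *\<^sub>R ?e - X *v ?e)"
    using upper u by (metis psd_def)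
  ultimately have "?e \<bullet> ((r *\<^sub>R mat 1 - X) *v ?e) = 0"
    by (simp add: u inner_diff_right)
  then have "(r *\<^sub>R mat 1 - X) *v ?e = 0"
    by (rule psd_isotropic_imp_kernel[OF upper])
  then show ?thesis by (simp add: u)
qed

lemma mat_inner_sum:
  fixes X Y :: "real^'n^'n"
  shows "mat_inner X Y = (\<Sum>i\<in>UNIV. \<Sum>j\<in>UNIV. X $ i $ j * Y $ i $ j)"
  unfolding mat_inner_def trace_def matrix_matrix_mult_def transpose_def
  by (simp, rule sum.swap)

text \<open>The diagonal part of the Laplacian sees only the unit diagonal of \<open>X\<close>, so
  it contributes the sum of all entries of \<open>D\<close>, which is the inner product of
  \<open>D\<close> with \<open>ones_mat\<close>.\<close>

lemma mat_inner_laplacian: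
  fixes D X :: "real^'n^'n"
  assumes "diag_vec X = ones_vec"
  shows "mat_inner (laplacian D) X = mat_inner D (ones_mat - X)"
proof -
  have d: "X $ i $ i = 1" for i
    using assms by (simp add: diag_vec_def ones_vec_def vec_eq_iff)
  have "mat_inner (laplacian D) X = (\<Sum>i\<in>UNIV. (\<Sum>j\<in>UNIV.
      (if i = j then (\<Sum>l\<in>UNIV. D $ i $ l) * X $ i $ j else 0) - D $ i $ j * X $ i $ j))"
    unfolding mat_inner_sum
    by (intro sum.cong refl) (simp add: laplacian_def Diag_def mult_ones_vec_nth left_diff_distrib)
  also have "\<dots> = mat_inner D (ones_mat - X)"
    by (simp add: mat_inner_sum ones_mat_def sum_subtractf right_diff_distrib d)
  finally show ?thesis .
qed

text \<open>
  The diagonal of \<open>X2\<close> vanishes because \<open>X1\<close> and \<open>X2\<close> are nonnegative with \<open>X1 + X2 = J - I\<close>;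
  this is what makes \<open>I + X2\<close> binary with unit diagonal.
\<close>
lemma mixed_integer_sdp_feasible_iff:
  fixes X1 X2 :: "real^'n^'n"
  shows "(X1, X2) \<in> feasible (mixed_integer_sdp k m D) \<longleftrightarrow>
    (\<exists>X. X1 = ones_mat - X \<and> X2 = X - mat 1 \<and> diag_vec X = ones_vec \<and> sym_mat X \<and> binary_mat X \<and>
      psd (real m *\<^sub>R mat 1 - X) \<and> psd (real k *\<^sub>R X - ones_mat))"
    (is "?l \<longleftrightarrow> (\<exists>X. ?P X)")
proof
  assume l: ?l
  define X where "X = mat 1 + X2"
  have sum: "mat 1 + X1 + X2 = ones_mat" and sym: "sym_mat X2"
    and nonneg: "nonneg_mat X1" and bin: "binary_mat X2"
    and upper: "psd ((real m - 1) *\<^sub>R mat 1 - X2)"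
    and lower: "psd ((real k - 1) *\<^sub>R mat 1 - X1 + (real k - 1) *\<^sub>R X2)"
    using l by (auto simp: mixed_integer_sdp_def)
  have X1: "X1 = ones_mat - X" and X2: "X2 = X - mat 1"
    using sum by (auto simp: X_def algebra_simps)
  have z: "X2 $ i $ i = 0" for i
  proof -
    have "1 + X1 $ i $ i + X2 $ i $ i = 1"
      using arg_cong[OF sum, of "\<lambda>A. A $ i $ i"] by (simp add: mat_def ones_mat_def)
    then show ?thesis
      using nonneg bin by (smt (verit) nonneg_mat_def binary_mat_def insert_iff empty_iff)
  qed
  have "diag_vec X = ones_vec"
    by (simp add: diag_vec_def ones_vec_def X_def mat_def z)
  moreover have "sym_mat X"
    using sym_mat_nth[OF sym] by (intro sym_matI) (auto simp: X_def mat_def)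
  moreover have "binary_mat X"
    using bin z by (auto simp: X_def binary_mat_def mat_def)
  moreover have "(real m - 1) *\<^sub>R mat 1 - X2 = real m *\<^sub>R mat 1 - X"
    by (simp add: X2 algebra_simps)
  then have "psd (real m *\<^sub>R mat 1 - X)"
    using upper by simp
  \<comment> \<open>The multiples of the identity cancel; \<open>X1\<close> supplies one copy of
    \<open>X\<close> and \<open>X2\<close> the other \<open>k - 1\<close>.\<close>
  moreover have "(real k - 1) *\<^sub>R mat 1 - X1 + (real k - 1) *\<^sub>R X2 = real k *\<^sub>R X - ones_mat"
    by (simp add: X1 X2 algebra_simps)
  then have "psd (real k *\<^sub>R X - ones_mat)"
    using lower by simp
  ultimately have "?P X"
    using X1 X2 by blast
  then show "\<exists>X. ?P X" ..
next
  assume "\<exists>X. ?P X"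
  then obtain X where P: "?P X" ..
  then have eqs: "X1 = ones_mat - X" "X2 = X - mat 1" by blast+
  have d: "X $ i $ i = 1" for i
    using P by (simp add: diag_vec_def ones_vec_def vec_eq_iff)
  have s: "X $ i $ j = X $ j $ i" for i j
    using P by (intro sym_mat_nth) blast
  have b: "X $ i $ j = 0 \<or> X $ i $ j = 1" for i j
    using P by (simp add: binary_mat_def)
  have le: "X $ i $ j \<le> 1" for i j
    using b[of i j] by auto
  have "nonneg_mat X1"
    using P le by (simp add: nonneg_mat_def ones_mat_def)
  moreover have "binary_mat X2"
    using P b d by (simp add: binary_mat_def mat_def)
  moreover have "sym_mat X1"
    using P by (intro sym_matI) (simp add: ones_mat_def s)
  moreover have "sym_mat X2"
    using P s by (intro sym_matI) (auto simp: mat_def)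
  moreover have "mat 1 + X1 + X2 = ones_mat"
    using P by simp
  moreover have "(real m - 1) *\<^sub>R mat 1 - X2 = real m *\<^sub>R mat 1 - X"
    unfolding eqs by (simp add: algebra_simps)
  then have "psd ((real m - 1) *\<^sub>R mat 1 - X2)"
    using P by metis
  moreover have "(real k - 1) *\<^sub>R mat 1 - X1 + (real k - 1) *\<^sub>R X2 = real k *\<^sub>R X - ones_mat"
    unfolding eqs by (simp add: algebra_simps)
  then have "psd ((real k - 1) *\<^sub>R mat 1 - X1 + (real k - 1) *\<^sub>R X2)"
    using P by metis
  ultimately show ?l
    unfolding mixed_integer_sdp_def by simp
qed

theorem proposition10:
  fixes n k m :: nat and D :: "real^'n^'n"
  assumes "CARD('n) = n" and "0 < n" and "0 < k" and "0 < m" and "n = m * k"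
    and "sym_mat D" and "nonneg_mat D"
  shows "equivalent_problems (binary_sdp k (laplacian D)) (mixed_integer_sdp k m D)"
proof -
  have card: "real CARD('n) = real m * real k"
    using assms(1,5) by simp
  have ratio: "real CARD('n) / real k = real m"
    using \<open>0 < k\<close> by (simp add: card)
  \<comment> \<open>Both directions use the same correspondence between \<open>X\<close> and the
    pair, so one objective identity serves for both.\<close>
  have obj: "objective (mixed_integer_sdp k m D) (ones_mat - X, X - mat 1)
      = objective (binary_sdp k (laplacian D)) X" if "diag_vec X = ones_vec" for X
    by (simp add: mixed_integer_sdp_def binary_sdp_def mat_inner_laplacian[OF that])
  show ?thesis
    unfolding equivalent_problems_def
  proof (intro conjI ballI)
    fix X assume "X \<in> feasible (binary_sdp k (laplacian D))"
    then have X: "diag_vec X = ones_vec" "X *v ones_vec = real m *\<^sub>R ones_vec"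
      "psd (real k *\<^sub>R X - ones_mat)" "sym_mat X" "binary_mat X"
      by (simp_all add: binary_sdp_def ratio)
    have "nonneg_mat X"
      unfolding nonneg_mat_def
    proof (intro allI)
      fix i j
      have "X $ i $ j \<in> {0, 1}" using X(5) by (simp only: binary_mat_def)
      then show "0 \<le> X $ i $ j" by auto
    qed
    then have "psd (real m *\<^sub>R mat 1 - X)"
      using X by (intro psd_row_sum_minus)
    then have "(ones_mat - X, X - mat 1) \<in> feasible (mixed_integer_sdp k m D)"
      using X by (auto simp: mixed_integer_sdp_feasible_iff)
    then show "\<exists>y\<in>feasible (mixed_integer_sdp k m D).
        objective (mixed_integer_sdp k m D) y = objective (binary_sdp k (laplacian D)) X"
      using obj[OF X(1)] by blast
  next
    fix y assume y: "y \<in> feasible (mixed_integer_sdp k m D)"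
    obtain X1 X2 where "y = (X1, X2)" by (cases y)
    with y obtain X where X: "y = (ones_mat - X, X - mat 1)" "diag_vec X = ones_vec" "sym_mat X"
      "binary_mat X" "psd (real m *\<^sub>R mat 1 - X)" "psd (real k *\<^sub>R X - ones_mat)"
      by (auto simp: mixed_integer_sdp_feasible_iff)
    \<comment> \<open>The row-sum constraint is recovered by squeezing between the two semidefinite
      bounds, with \<open>r = m\<close> and \<open>s = k\<close>.\<close>
    have "X *v ones_vec = real m *\<^sub>R ones_vec"
      using X \<open>0 < k\<close> card by (intro row_sums_of_psd_bounds) auto
    then have "X \<in> feasible (binary_sdp k (laplacian D))"
      using X by (simp add: binary_sdp_def ratio)
    then show "\<exists>x\<in>feasible (binary_sdp k (laplacian D)).
        objective (binary_sdp k (laplacian D)) x = objective (mixed_integer_sdp k m D) y"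
      using obj[OF X(2)] X(1) by metis
  qed
qed

end
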